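(* Let $a\in\mathbb{R}$, $\mu_1,\mu_2\in\mathbb{R}$, $\sigma_1,\sigma_2>0$, and let $p(t;x,z)$ be the transition density of the unique strong solution $X$ of $$\mathrm{d} X_t=(\mu_1 \mathbf{1}_{\{X_t \le a\}}+\mu_2 \mathbf{1}_{\{X_t> a\}})\,\mathrm{d} t+(\sigma_1\mathbf{1}_{\{X_t\le a\}}+\sigma_2\mathbf{1}_{\{X_t> a\}})\,\mathrm{d} B_t .$$ Then for every $t>0$ and every fixed $z\in\mathbb{R}\setminus\{a\}$, the function $x\mapsto p(t;x,z)$ is continuous on $\mathbb{R}$.
   Context: $B$ is a standard one-dimensional Brownian motion; the stochastic differential equation is known to have a unique strong solution. The function $h$ is $h(t ; x, \mu):=\frac{|x|}{\sqrt{2 \pi t^3}} \exp [-\frac{(x+\mu t)^2}{2 t}]$ for $t>0$, $x,\mu\in\mathbb{R}$. The transition density $p(t;x,z)$ (density in $z$ of the law of $X_t$ given $X_0=x$) is understood as the following version. For $x\ge a$, $z\ge a$: $$\begin{aligned}p(t;x,z)=\;&\frac{2}{\sigma_2^2} \int_0^{\infty}\!\! \int_0^{t} e^{\frac{2\mu_2(z-a)}{\sigma_2^2}}e^{\frac{2\mu_1b}{\sigma_1^2}}\, h\!\left(t-\tau ; \tfrac{b}{\sigma_1}, \tfrac{\mu_1}{\sigma_1}\right) h\!\left(\tau ;\tfrac{z+x-2a+b}{\sigma_2},\tfrac{ \mu_2}{\sigma_2}\right) \mathrm{d} \tau\, \mathrm{d} b\\ &+\frac{1}{\sqrt{2 \pi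 t\sigma_2^2}} \left[\exp \left(-\frac{(z-x-\mu_2t)^2}{2 t\sigma_2^2}\right)-\exp \left(-\frac{(z+x-2a-\mu_2t)^2}{2t\sigma_2^2}-\frac{2 \mu_2(x-a)}{\sigma_2^2}\right)\right].\end{aligned}$$ For $x\ge a$, $z<a$: $$p(t;x,z)=\frac{2}{\sigma_1^2} \int_0^{\infty}\!\! \int_0^{t} e^{\frac{2\mu_1b}{\sigma_1^2}}\, h\!\left(t-\tau ; \tfrac{b-z+a}{\sigma_1}, \tfrac{\mu_1}{\sigma_1}\right) h\!\left(\tau ;\tfrac{x-a+b}{\sigma_2},\tfrac{ \mu_2}{\sigma_2}\right) \mathrm{d} \tau\, \mathrm{d} b.$$ For $x<a$, $z\le a$: $$\begin{aligned}p(t;x,z)=\;&\frac{2}{\sigma_1^2} \int_{-\infty}^{0}\! \int_0^{t} e^{\frac{2\mu_1(z-a)}{\sigma_1^2}} e^{\frac{2\mu_2b}{\sigma_2^2}}\, h\!\left(t-\tau ; \tfrac{b}{\sigma_2}, \tfrac{\mu_2}{\sigma_2}\right) h\!\left(\tau ;\tfrac{z+x-2a+b}{\sigma_1},\tfrac{ \mu_1}{\sigma_1}\right) \mathrm{d} \tau\, \mathrm{d} b\\ &+\frac{1}{\sqrt{2 \pi t\sigma_1^2}} \left[\exp \left(-\frac{(z-x-\mu_1t)^2}{2 t\sigma_1^2}\right)-\exp \left(-\frac{(z+x-2a-\mu_1t)^2}{2t\sigma_1^2}-\frac{2 \mu_1(x-a)}{\sigma_1^2}\right)\right].\end{aligned}$$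 For $x<a$, $z>a$: $$p(t;x,z)=\frac{2}{\sigma_2^2} \int_{-\infty}^{0}\! \int_0^{t} e^{\frac{2\mu_2b}{\sigma_2^2}}\, h\!\left(t-\tau ; \tfrac{b-z+a}{\sigma_2}, \tfrac{\mu_2}{\sigma_2}\right) h\!\left(\tau ;\tfrac{x-a+b}{\sigma_1},\tfrac{ \mu_1}{\sigma_1}\right) \mathrm{d} \tau\, \mathrm{d} b.$$ *)

theory Defs
  imports "HOL-Probability.Probability"
begin

definition standard_brownian_motion :: "'w measure \<Rightarrow> (real \<Rightarrow> 'w \<Rightarrow> real) \<Rightarrow> bool" where
  "standard_brownian_motion M B \<longleftrightarrow>
     prob_space M \<and>
     (\<forall>t\<ge>0. B t \<in> borel_measurable M) \<and>
     (\<forall>\<omega>\<in>space M. B 0 \<omega> = 0 \<and> continuous_on {0..} (\<lambda>t. B t \<omega>)) \<and>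
     (\<forall>s t. 0 \<le> s \<and> s < t \<longrightarrow>
        distributed M lborel (\<lambda>\<omega>. B t \<omega> - B s \<omega>)
          (\<lambda>y. ennreal (normal_density 0 (sqrt (t - s)) y))) \<and>
     (\<forall>(n::nat) (r :: nat \<Rightarrow> real). 0 \<le> r 0 \<and> (\<forall>i<n. r i < r (Suc i)) \<longrightarrow>
        prob_space.indep_vars M (\<lambda>_. borel) (\<lambda>i \<omega>. B (r (Suc i)) \<omega> - B (r i) \<omega>) {..<n})"

text \<open>The filtration generated by \<open>B\<close>, augmented by the null sets of \<open>M\<close>.\<close>

definition brownian_filtration :: "'w measure \<Rightarrow> (real \<Rightarrow> 'w \<Rightarrow> real) \<Rightarrow> real \<Rightarrow> 'w measure" where
  "brownian_filtration M B t =
     sigma (space M)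
       ({B s -` A \<inter> space M | s A. 0 \<le> s \<and> s \<le> t \<and> A \<in> sets borel} \<union> null_sets M)"

text \<open>A simple process on \<open>[0, t]\<close> is given by a partition \<open>0 = r 0 \<le> \<dots> \<le> r n = t\<close>
  and bounded random variables \<open>\<xi> i\<close>, the value on \<open>(r i, r (i + 1)]\<close>, known at time \<open>r i\<close>.\<close>

definition simple_process ::
  "'w measure \<Rightarrow> (real \<Rightarrow> 'w measure) \<Rightarrow> real \<Rightarrow> nat \<Rightarrow> (nat \<Rightarrow> real) \<Rightarrow> (nat \<Rightarrow> 'w \<Rightarrow> real) \<Rightarrow> bool"
where
  "simple_process M F t n r \<xi> \<longleftrightarrow>
     r 0 = 0 \<and> r n = t \<and>
     (\<forall>i<n. r i \<le> r (Suc i) \<and> \<xi> i \<in> borel_measurable (F (r i)) \<and>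
            (\<exists>C. \<forall>\<omega>\<in>space M. \<bar>\<xi> i \<omega>\<bar> \<le> C))"

definition simple_process_val :: "nat \<Rightarrow> (nat \<Rightarrow> real) \<Rightarrow> (nat \<Rightarrow> 'w \<Rightarrow> real) \<Rightarrow> real \<Rightarrow> 'w \<Rightarrow> real" where
  "simple_process_val n r \<xi> s \<omega> = (\<Sum>i<n. \<xi> i \<omega> * indicator {r i<..r (Suc i)} s)"

definition simple_ito_integral ::
  "(real \<Rightarrow> 'w \<Rightarrow> real) \<Rightarrow> nat \<Rightarrow> (nat \<Rightarrow> real) \<Rightarrow> (nat \<Rightarrow> 'w \<Rightarrow> real) \<Rightarrow> 'w \<Rightarrow> real" where
  "simple_ito_integral B n r \<xi> \<omega> = (\<Sum>i<n. \<xi> i \<omega> * (B (r (Suc i)) \<omega> - B (r i) \<omega>))"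

text \<open>\<open>Y\<close> is a version of the Ito integral of \<open>H\<close> against \<open>B\<close> over \<open>[0, t]\<close>: the \<open>L\<^sup>2\<close>-limit
  of the integrals of simple processes that converge to \<open>H\<close> in \<open>L\<^sup>2\<close> of \<open>[0, t] \<times> M\<close>.\<close>

definition has_ito_integral ::
  "'w measure \<Rightarrow> (real \<Rightarrow> 'w measure) \<Rightarrow> (real \<Rightarrow> 'w \<Rightarrow> real) \<Rightarrow> real \<Rightarrow>
   (real \<Rightarrow> 'w \<Rightarrow> real) \<Rightarrow> ('w \<Rightarrow> real) \<Rightarrow> bool"
where
  "has_ito_integral M F B t H Y \<longleftrightarrow>
     (\<lambda>(s, \<omega>). H s \<omega>) \<in> borel_measurable (restrict_space lborel {0..t} \<Otimes>\<^sub>M M) \<and>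
     Y \<in> borel_measurable M \<and>
     (\<exists>n r \<xi>.
        (\<forall>k::nat. simple_process M F t (n k) (r k) (\<xi> k)) \<and>
        (\<lambda>k. \<integral>\<^sup>+\<omega>. (\<integral>\<^sup>+s\<in>{0..t}.
               ennreal ((simple_process_val (n k) (r k) (\<xi> k) s \<omega> - H s \<omega>)\<^sup>2) \<partial>lborel) \<partial>M)
          \<longlonglongrightarrow> 0 \<and>
        (\<lambda>k. \<integral>\<^sup>+\<omega>. ennreal ((simple_ito_integral B (n k) (r k) (\<xi> k) \<omega> - Y \<omega>)\<^sup>2) \<partial>M)
          \<longlonglongrightarrow> 0)"

text \<open>\<open>X\<close> is a strong solution of \<open>dX = drift(X) dt + diff(X) dB\<close>, \<open>X\<^sub>0 = x\<close>, for bounded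
  coefficients (so that the integrand \<open>diff(X)\<close> is square integrable).  The initial condition is
  the case \<open>t = 0\<close> of the integral equation.\<close>

definition strong_solution ::
  "'w measure \<Rightarrow> (real \<Rightarrow> 'w \<Rightarrow> real) \<Rightarrow> (real \<Rightarrow> real) \<Rightarrow> (real \<Rightarrow> real) \<Rightarrow> real \<Rightarrow>
   (real \<Rightarrow> 'w \<Rightarrow> real) \<Rightarrow> bool"
where
  "strong_solution M B drift diff x X \<longleftrightarrow>
     (\<forall>\<omega>\<in>space M. continuous_on {0..} (\<lambda>t. X t \<omega>)) \<and>
     (\<forall>t\<ge>0. X t \<in> borel_measurable (brownian_filtration M B t)) \<and>
     (\<forall>t\<ge>0. \<exists>Y. has_ito_integral M (brownian_filtration M B) B t (\<lambda>s \<omega>. diff (X s \<omega>)) Y \<and>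
        (AE \<omega> in M. X t \<omega> = x + (LINT s:{0..t}|lborel. drift (X s \<omega>)) + Y \<omega>))"

definition two_valued :: "real \<Rightarrow> real \<Rightarrow> real \<Rightarrow> real \<Rightarrow> real" where
  "two_valued a c1 c2 y = c1 * indicator {..a} y + c2 * indicator {a<..} y"

text \<open>\<open>X x\<close> is the process started at \<open>x\<close>.  As \<open>ennreal\<close> truncates negative numbers to \<open>0\<close>,
  nonnegativity of \<open>p\<close> is required separately.\<close>

definition transition_density ::
  "'w measure \<Rightarrow> (real \<Rightarrow> real \<Rightarrow> 'w \<Rightarrow> real) \<Rightarrow> (real \<Rightarrow> real \<Rightarrow> real \<Rightarrow> real) \<Rightarrow> bool" where
  "transition_density M X p \<longleftrightarrow>
     (\<forall>t>0. \<forall>x. (\<forall>z. 0 \<le> p t x z) \<and>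
        distributed M lborel (X x t) (\<lambda>z. ennreal (p t x z)))"

definition hit_density :: "real \<Rightarrow> real \<Rightarrow> real \<Rightarrow> real" where
  "hit_density t x \<mu> = \<bar>x\<bar> / sqrt (2 * pi * t ^ 3) * exp (- ((x + \<mu> * t)\<^sup>2) / (2 * t))"

definition explicit_density ::
  "real \<Rightarrow> real \<Rightarrow> real \<Rightarrow> real \<Rightarrow> real \<Rightarrow> real \<Rightarrow> real \<Rightarrow> real \<Rightarrow> real" where
  "explicit_density a \<mu>1 \<mu>2 \<sigma>1 \<sigma>2 t x z =
    (if a \<le> x then
       (if a \<le> z then
          2 / \<sigma>2\<^sup>2 *
            (LINT b:{0<..}|lborel. LINT \<tau>:{0<..<t}|lborel.
               exp (2 * \<mu>2 * (z - a) / \<sigma>2\<^sup>2) * exp (2 * \<mu>1 * b / \<sigma>1\<^sup>2) *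
               hit_density (t - \<tau>) (b / \<sigma>1) (\<mu>1 / \<sigma>1) *
               hit_density \<tau> ((z + x - 2 * a + b) / \<sigma>2) (\<mu>2 / \<sigma>2)) +
          1 / sqrt (2 * pi * t * \<sigma>2\<^sup>2) *
            (exp (- ((z - x - \<mu>2 * t)\<^sup>2) / (2 * t * \<sigma>2\<^sup>2)) -
             exp (- ((z + x - 2 * a - \<mu>2 * t)\<^sup>2) / (2 * t * \<sigma>2\<^sup>2) - 2 * \<mu>2 * (x - a) / \<sigma>2\<^sup>2))
        else
          2 / \<sigma>1\<^sup>2 *
            (LINT b:{0<..}|lborel. LINT \<tau>:{0<..<t}|lborel.
               exp (2 * \<mu>1 * b / \<sigma>1\<^sup>2) *
               hit_density (t - \<tau>) ((b - z + a) / \<sigma>1) (\<mu>1 / \<sigma>1) *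
               hit_density \<tau> ((x - a + b) / \<sigma>2) (\<mu>2 / \<sigma>2)))
     else
       (if z \<le> a then
          2 / \<sigma>1\<^sup>2 *
            (LINT b:{..<0}|lborel. LINT \<tau>:{0<..<t}|lborel.
               exp (2 * \<mu>1 * (z - a) / \<sigma>1\<^sup>2) * exp (2 * \<mu>2 * b / \<sigma>2\<^sup>2) *
               hit_density (t - \<tau>) (b / \<sigma>2) (\<mu>2 / \<sigma>2) *
               hit_density \<tau> ((z + x - 2 * a + b) / \<sigma>1) (\<mu>1 / \<sigma>1)) +
          1 / sqrt (2 * pi * t * \<sigma>1\<^sup>2) *
            (exp (- ((z - x - \<mu>1 * t)\<^sup>2) / (2 * t * \<sigma>1\<^sup>2)) -
             exp (- ((z + x - 2 * a - \<mu>1 * t)\<^sup>2) / (2 * t * \<sigma>1\<^sup>2) - 2 * \<mu>1 * (x - a) / \<sigma>1\<^sup>2))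
        else
          2 / \<sigma>2\<^sup>2 *
            (LINT b:{..<0}|lborel. LINT \<tau>:{0<..<t}|lborel.
               exp (2 * \<mu>2 * b / \<sigma>2\<^sup>2) *
               hit_density (t - \<tau>) ((b - z + a) / \<sigma>2) (\<mu>2 / \<sigma>2) *
               hit_density \<tau> ((x - a + b) / \<sigma>1) (\<mu>1 / \<sigma>1))))"

end

theory Submission
  imports Defs
begin

text \<open>The substitutions \<open>b \<mapsto> - b\<close> and \<open>\<tau> \<mapsto> t - \<tau>\<close> bring the integrals in all four branches of
  the density into one form,
  \<open>G(u, w) = \<integral>\<^sub>0\<^sup>\<infinity> \<integral>\<^sub>0\<^sup>t e\<^bsup>cb\<^esup> h(t - \<tau>; (b + w) / s\<^sub>2, m\<^sub>2) h(\<tau>; (b + u) / s\<^sub>1, m\<^sub>1) d\<tau> db\<close>,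
  where \<open>u \<ge> 0\<close> and \<open>w \<ge> \<bar>z - a\<bar> > 0\<close> depend continuously on \<open>x\<close>.  The integrand has a
  multiple of \<open>b\<^bsup>-1/2\<^esup> e\<^bsup>-b\<^esup> \<tau>\<^bsup>-3/4\<^esup>\<close> as an integrable majorant, so dominated convergence gives
  continuity on either side of \<open>a\<close>.  At \<open>x = a\<close> the Gaussian terms cancel and the identity
  \<open>h(t; y, -m) = e\<^bsup>2my\<^esup> h(t; y, m)\<close> matches the two one-sided expressions.\<close>

section \<open>Elementary identities for the first-passage density\<close>

lemma hit_density_nonneg: "t > 0 \<Longrightarrow> hit_density t y m \<ge> 0"
  by (simp add: hit_density_def)

lemma hit_density_minus: "hit_density t (- y) m = hit_density t y (- m)"
proof -
  have "(- y + m * t)\<^sup>2 = (y + - m * t)\<^sup>2" by algebra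
  then show ?thesis by (simp add: hit_density_def)
qed

text \<open>The two squares differ by \<open>4 * y * m * t\<close>, so the exponents differ by
  \<open>2 * m * y\<close>, independently of \<open>t\<close>. A change of drift thus costs only a
  factor that leaves the time integral.\<close>

lemma hit_density_minus_drift:
  assumes "t > 0"
  shows "hit_density t y (- m) = exp (2 * m * y) * hit_density t y m"
proof -
  have "- ((y + - m * t)\<^sup>2) / (2 * t) = 2 * m * y + - ((y + m * t)\<^sup>2) / (2 * t)"
    using assms by (simp add: field_simps power2_eq_square)
  then show ?thesis
    unfolding hit_density_def by (simp only: exp_add mult_ac)
qed

lemma measurable_hit_density[measurable]:
  assumes [measurable]: "f \<in> borel_measurable N" "g \<in> borel_measurable N"
  shows "(\<lambda>x. hit_density (f x) (g x) m) \<in> borel_measurable N"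
  unfolding hit_density_def by measurable

lemma continuous_on_hit_density[continuous_intros]:
  assumes "t > 0" "continuous_on S f"
  shows "continuous_on S (\<lambda>x. hit_density t (f x) m)"
  unfolding hit_density_def using assms by (intro continuous_intros) auto

section \<open>Bounds for the first-passage density\<close>

text \<open>Half of the quadratic decay is kept in the scaled variable \<open>y / sqrt s\<close>, to
  absorb singularities at small \<open>s\<close>. The other half, weakened from \<open>s\<close> to
  \<open>t\<close>, pays for the drift and for exponential decay in \<open>y\<close> at any chosen
  rate \<open>k\<close>, uniformly in \<open>s \<le> t\<close>.\<close>

lemma gaussian_exponent_bound:
  fixes t s y m k :: real
  assumes "0 < s" "s \<le> t" "0 \<le> y"
  shows "exp (- ((y + m * s)\<^sup>2) / (2 * s))
       \<le> exp (t * (\<bar>m\<bar> + k)\<^sup>2) * exp (- k * y) * exp (- (y / sqrt s)\<^sup>2 / 4)"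
proof -
  have t: "t > 0" using assms by linarith
  have "- ((y + m * s)\<^sup>2) / (2 * s) = - y\<^sup>2 / (2 * s) - m * y - m\<^sup>2 * s / 2"
    using assms by (simp add: field_simps power2_eq_square)
  also have "\<dots> \<le> - y\<^sup>2 / (2 * s) + \<bar>m\<bar> * y"
  proof -
    have "- m * y \<le> \<bar>m\<bar> * y" using assms by (intro mult_right_mono) auto
    moreover have "m\<^sup>2 * s / 2 \<ge> 0" using assms by simp
    ultimately show ?thesis by linarith
  qed
  also have "\<dots> = - y\<^sup>2 / (4 * s) - y\<^sup>2 / (4 * s) + \<bar>m\<bar> * y"
    by simp
  also have "\<dots> \<le> - y\<^sup>2 / (4 * s) - y\<^sup>2 / (4 * t) + \<bar>m\<bar> * y"
    using divide_left_mono[of "4 * s" "4 * t" "y\<^sup>2"] assms t by simp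
  also have "\<dots> \<le> t * (\<bar>m\<bar> + k)\<^sup>2 + (- k * y) + - (y / sqrt s)\<^sup>2 / 4"
  proof -
    \<comment> \<open>Completing this square gives \<open>y * (\<bar>m\<bar> + k) \<le> y^2 / (4 *
      t) + t * (\<bar>m\<bar> + k)^2\<close>.\<close>
    have "0 \<le> (y / (2 * sqrt t) - sqrt t * (\<bar>m\<bar> + k))\<^sup>2" by simp
    also have "\<dots> = y\<^sup>2 / (4 * t) - y * (\<bar>m\<bar> + k) + t * (\<bar>m\<bar> + k)\<^sup>2"
      using t by (simp add: power2_diff power_divide power_mult_distrib)
    finally show ?thesis
      using assms by (simp add: power_divide algebra_simps)
  qed
  finally show ?thesis by (simp add: exp_add[symmetric])
qed

text \<open>These are the powers of \<open>w = y / sqrt s\<close> that must be absorbed when the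
  prefactor of the density is rewritten; the constants are not sharp.\<close>

lemma powr_exp_bounds:
  fixes w :: real
  assumes "w \<ge> 0"
  shows "w powr (3/2) * exp (- w\<^sup>2 / 4) \<le> 4" "w ^ 3 * exp (- w\<^sup>2 / 4) \<le> 65"
proof -
  have e: "exp (- w\<^sup>2 / 4) = 1 / exp (w\<^sup>2 / 4)" by (simp add: exp_minus field_simps)
  have "w powr (3/2) \<le> 1 + w\<^sup>2"
  proof (cases "w \<le> 1")
    case True
    have "w powr (3/2) \<le> 1 powr (3/2)" using True assms by (intro powr_mono2) auto
    then show ?thesis by (smt (verit) powr_one_eq_one zero_le_power2)
  next
    case False
    then have "w powr (3/2) \<le> w powr 2" by (intro powr_mono) auto
    also have "w powr 2 = w\<^sup>2" using False by simp
    finally show ?thesis by simp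
  qed
  moreover have "1 + w\<^sup>2 / 4 \<le> exp (w\<^sup>2 / 4)" by (rule exp_ge_add_one_self)
  ultimately show "w powr (3/2) * exp (- w\<^sup>2 / 4) \<le> 4"
    unfolding e by (simp add: field_simps)
  \<comment> \<open>Squaring the linear bound at \<open>w^2 / 8\<close> produces the quartic term
    \<open>w^4 / 64\<close>, whence \<open>65 = 1 + 64\<close>.\<close>
  have "(1 + w\<^sup>2 / 8)\<^sup>2 \<le> (exp (w\<^sup>2 / 8))\<^sup>2"
    by (intro power_mono exp_ge_add_one_self) simp
  also have "\<dots> = exp (w\<^sup>2 / 4)" by (simp add: exp_double[symmetric])
  finally have 2: "1 + w\<^sup>2 / 4 + w ^ 4 / 64 \<le> exp (w\<^sup>2 / 4)"
    by (simp add: power2_eq_square power4_eq_xxxx field_simps)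
  have "w ^ 3 \<le> 1 + w ^ 4"
  proof (cases "w \<le> 1")
    case True
    then have "w ^ 3 \<le> 1" using assms by (simp add: power_le_one)
    then show ?thesis by (smt (verit) zero_le_even_power' assms zero_le_power)
  next
    case False
    then have "w ^ 3 \<le> w ^ 4" by (intro power_increasing) auto
    then show ?thesis by simp
  qed
  also have "\<dots> \<le> 65 * exp (w\<^sup>2 / 4)"
    using 2 zero_le_power[OF assms, of 4] zero_le_power[OF assms, of 2] by linarith
  finally show "w ^ 3 * exp (- w\<^sup>2 / 4) \<le> 65"
    unfolding e by (simp add: field_simps)
qed

text \<open>With \<open>w = y / sqrt s\<close>, the prefactor \<open>y * s powr (-3/2)\<close> is
  split in two ways. As \<open>w powr (3/2) * y powr (-1/2) * s powr (-3/4)\<close> its singularity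
  is shared so that both exponents exceed -1; as \<open>w^3 / y^2\<close> it has no singularity in
  \<open>s\<close>, which serves for \<open>y\<close> away from 0.\<close>

lemma hit_density_le:
  assumes "0 < s" "s \<le> t" "0 < y"
  shows "hit_density s y m
       \<le> 4 * exp (t * (\<bar>m\<bar> + k)\<^sup>2) * y powr (-1/2) * exp (- k * y) * s powr (-3/4)"
    and "hit_density s y m \<le> 65 * exp (t * m\<^sup>2) / y\<^sup>2"
proof -
  define w where "w = y / sqrt s"
  have w: "w > 0" using assms by (simp add: w_def)
  have s3: "sqrt (s ^ 3) = s powr (3/2)"
    using assms by (simp add: powr_half_sqrt[symmetric] powr_realpow[symmetric] powr_powr del: powr_numeral)
  have "sqrt (s ^ 3) \<le> sqrt (2 * pi * s ^ 3)"
    using assms pi_gt3 by (intro real_sqrt_le_mono mult_right_le_one_le)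
      (auto simp: field_simps)
  then have le: "hit_density s y m \<le> y / sqrt (s ^ 3) * exp (- ((y + m * s)\<^sup>2) / (2 * s))"
    unfolding hit_density_def using assms
    by (intro mult_right_mono frac_le) auto
  have A: "y / sqrt (s ^ 3) = w powr (3/2) * y powr (-1/2) * s powr (-3/4)"
  proof -
    have "w powr (3/2) = y powr (3/2) / s powr (3/4)"
      using assms by (simp add: w_def powr_divide powr_half_sqrt[symmetric] powr_powr)
    then have "w powr (3/2) * y powr (-1/2) * s powr (-3/4)
        = (y powr (3/2) * y powr (-1/2)) / (s powr (3/4) * s powr (3/4))"
      by (simp add: powr_minus_divide)
    also have "\<dots> = y / s powr (3/2)"
      using assms by (simp flip: powr_add)
    finally show ?thesis unfolding s3 by simp
  qed
  have B: "y / sqrt (s ^ 3) = w ^ 3 / y\<^sup>2"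
    using assms by (simp add: w_def power_divide real_sqrt_mult power2_eq_square power3_eq_cube)
  note g = gaussian_exponent_bound[OF assms(1,2) less_imp_le[OF assms(3)], folded w_def]
  have "hit_density s y m \<le> w powr (3/2) * y powr (-1/2) * s powr (-3/4) *
      (exp (t * (\<bar>m\<bar> + k)\<^sup>2) * exp (- k * y) * exp (- w\<^sup>2 / 4))"
    by (rule order_trans[OF le[unfolded A]]) (intro mult_left_mono g, simp)
  also have "\<dots> = (w powr (3/2) * exp (- w\<^sup>2 / 4)) *
      (y powr (-1/2) * s powr (-3/4) * exp (t * (\<bar>m\<bar> + k)\<^sup>2) * exp (- k * y))"
    by (simp add: mult_ac)
  also have "\<dots> \<le> 4 * (y powr (-1/2) * s powr (-3/4) * exp (t * (\<bar>m\<bar> + k)\<^sup>2) * exp (- k * y))"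
    by (intro mult_right_mono powr_exp_bounds) (use w in auto)
  finally show "hit_density s y m
       \<le> 4 * exp (t * (\<bar>m\<bar> + k)\<^sup>2) * y powr (-1/2) * exp (- k * y) * s powr (-3/4)"
    by (simp add: mult_ac)
  \<comment> \<open>The choice \<open>k = 0\<close> suffices here, since no decay in
    \<open>y\<close> is kept beyond \<open>1 / y^2\<close>.\<close>
  have "hit_density s y m \<le> w ^ 3 / y\<^sup>2 *
      (exp (t * (\<bar>m\<bar> + 0)\<^sup>2) * exp (- 0 * y) * exp (- w\<^sup>2 / 4))"
    by (rule order_trans[OF le[unfolded B]]) (intro mult_left_mono g, use w in simp)
  also have "\<dots> = (w ^ 3 * exp (- w\<^sup>2 / 4)) * (exp (t * m\<^sup>2) / y\<^sup>2)"
    by simp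
  also have "\<dots> \<le> 65 * (exp (t * m\<^sup>2) / y\<^sup>2)"
    by (intro mult_right_mono powr_exp_bounds) (use w in auto)
  finally show "hit_density s y m \<le> 65 * exp (t * m\<^sup>2) / y\<^sup>2" by simp
qed

section \<open>Continuity of dominated iterated integrals\<close>

text \<open>Dominated convergence is applied along sequences, first in \<open>\<tau>\<close> for
  fixed \<open>b\<close>, then in \<open>b\<close>. The product form of the majorant makes the inner
  integral at most \<open>u b\<close> times a constant, which is the majorant for the outer
  one.\<close>

lemma continuous_on_iterated_integral:
  fixes f :: "'a :: metric_space \<Rightarrow> real \<Rightarrow> real \<Rightarrow> real"
  assumes [measurable]: "A \<in> sets borel" "T \<in> sets borel"
    and u: "set_integrable lborel A u" and v: "set_integrable lborel T v"
    and [measurable]: "\<And>x. x \<in> S \<Longrightarrow> case_prod (f x) \<in> borel_measurable (borel \<Otimes>\<^sub>M borel)"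
    and cont: "\<And>b \<tau>. b \<in> A \<Longrightarrow> \<tau> \<in> T \<Longrightarrow> continuous_on S (\<lambda>x. f x b \<tau>)"
    and bound: "\<And>x b \<tau>. x \<in> S \<Longrightarrow> b \<in> A \<Longrightarrow> \<tau> \<in> T \<Longrightarrow> \<bar>f x b \<tau>\<bar> \<le> u b * v \<tau>"
  shows "continuous_on S (\<lambda>x. LINT b:A|lborel. LINT \<tau>:T|lborel. f x b \<tau>)"
  unfolding continuous_on_sequentially comp_def
proof (intro allI ballI impI, elim conjE)
  fix X x assume x: "x \<in> S" and X: "\<forall>n. X n \<in> S" and lim: "X \<longlonglongrightarrow> x"
  have [measurable]: "case_prod (f x) \<in> borel_measurable (borel \<Otimes>\<^sub>M borel)"
    "\<And>n. case_prod (f (X n)) \<in> borel_measurable (borel \<Otimes>\<^sub>M borel)"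
    using x X assms(5) by auto
  have flim: "(\<lambda>n. f (X n) b \<tau>) \<longlonglongrightarrow> f x b \<tau>" if "b \<in> A" "\<tau> \<in> T" for b \<tau>
    using cont[OF that] x X lim by (auto simp: continuous_on_sequentially comp_def)
  have fbound: "\<bar>LINT \<tau>:T|lborel. f y b \<tau>\<bar> \<le> u b * (LINT \<tau>:T|lborel. v \<tau>)" if "y \<in> S" "b \<in> A" for y b
  proof -
    have [measurable]: "f y b \<in> borel_measurable borel"
      using measurable_Pair2[OF assms(5)[OF that(1)], of b] by simp
    have int: "set_integrable lborel T (\<lambda>\<tau>. u b * v \<tau>)" using v by simp
    have "set_integrable lborel T (f y b)"
      using int bound[OF that]
      by (elim set_integrable_bound)
        (auto simp: set_borel_measurable_def simp del: abs_mult intro!: AE_I2 intro: order_trans[OF _ abs_ge_self])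
    then have "\<bar>LINT \<tau>:T|lborel. f y b \<tau>\<bar> \<le> (LINT \<tau>:T|lborel. \<bar>f y b \<tau>\<bar>)"
      using set_integral_norm_bound[of lborel T "f y b"] by simp
    also have "\<dots> \<le> (LINT \<tau>:T|lborel. u b * v \<tau>)"
      using \<open>set_integrable lborel T (f y b)\<close> int bound[OF that]
      by (intro set_integral_mono set_integrable_abs) auto
    finally show ?thesis by simp
  qed
  show "(\<lambda>n. LINT b:A|lborel. LINT \<tau>:T|lborel. f (X n) b \<tau>) \<longlonglongrightarrow> (LINT b:A|lborel. LINT \<tau>:T|lborel. f x b \<tau>)"
    unfolding set_lebesgue_integral_def[of _ A]
  proof (rule integral_dominated_convergence[where w="\<lambda>b. indicator A b *\<^sub>R (u b * (LINT \<tau>:T|lborel. v \<tau>))"])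
    show "integrable lborel (\<lambda>b. indicator A b *\<^sub>R (u b * (LINT \<tau>:T|lborel. v \<tau>)))"
      using set_integrable_mult_left[of "LINT \<tau>:T|lborel. v \<tau>" lborel A u] u
      by (simp add: set_integrable_def)
    show "AE b in lborel. (\<lambda>n. indicator A b *\<^sub>R (LINT \<tau>:T|lborel. f (X n) b \<tau>))
        \<longlonglongrightarrow> indicator A b *\<^sub>R (LINT \<tau>:T|lborel. f x b \<tau>)"
    proof (rule AE_I2)
      fix b
      have "(\<lambda>n. LINT \<tau>:T|lborel. f (X n) b \<tau>) \<longlonglongrightarrow> (LINT \<tau>:T|lborel. f x b \<tau>)" if "b \<in> A"
        unfolding set_lebesgue_integral_def
      proof (rule integral_dominated_convergence[where w="\<lambda>\<tau>. indicator T \<tau> *\<^sub>R (u b * v \<tau>)"])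
        show "integrable lborel (\<lambda>\<tau>. indicator T \<tau> *\<^sub>R (u b * v \<tau>))"
          using set_integrable_mult_right[of "u b" lborel T v] v by (simp add: set_integrable_def)
      qed (use flim bound x X that in \<open>auto simp: indicator_def\<close>)
      then show "(\<lambda>n. indicator A b *\<^sub>R (LINT \<tau>:T|lborel. f (X n) b \<tau>))
        \<longlonglongrightarrow> indicator A b *\<^sub>R (LINT \<tau>:T|lborel. f x b \<tau>)"
        by (auto simp: indicator_def)
    qed
  qed (use fbound X in \<open>auto simp: indicator_def set_lebesgue_integral_def[of _ T]\<close>)
qed

section \<open>Integrable majorants and reflections of integrals\<close>

lemma set_integrable_powr_Ioo:
  fixes t p :: real
  assumes "t \<ge> 0" "p > -1"
  shows "set_integrable lborel {0<..<t} (\<lambda>\<tau>. \<tau> powr p)"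
proof -
  \<comment> \<open>Nonnegativity turns gauge integrability into absolute integrability; Borel
    measurability then allows the passage from \<open>lebesgue\<close> to
    \<open>lborel\<close>.\<close>
  have "set_integrable lebesgue {0<..t} (\<lambda>\<tau>. \<tau> powr p)"
    by (intro nonnegative_absolutely_integrable_1 integrable_on_powr_from_0') (use assms in auto)
  then have "set_integrable lborel {0<..t} (\<lambda>\<tau>. \<tau> powr p)"
    unfolding set_integrable_def by (subst (asm) integrable_completion) auto
  then show ?thesis by (rule set_integrable_subset) auto
qed

lemma set_integrable_powr_exp_Ioi:
  fixes p :: real
  assumes "p > -1"
  shows "set_integrable lborel {0<..} (\<lambda>b. b powr p * exp (- b))"
proof -
  \<comment> \<open>The exponent is left unsimplified to match the Gamma integrand at
    \<open>p + 1\<close>.\<close>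
  have "(\<lambda>b. b powr (p + 1 - 1) / exp b) integrable_on {0..}"
    using Gamma_integral_real[of "p + 1"] assms by (auto simp: integrable_on_def)
  then have "set_integrable lebesgue {0..} (\<lambda>b. b powr p * exp (- b))"
    by (intro nonnegative_absolutely_integrable_1) (auto simp: exp_minus field_simps)
  then have "set_integrable lborel {0..} (\<lambda>b. b powr p * exp (- b))"
    unfolding set_integrable_def by (subst (asm) integrable_completion) auto
  then show ?thesis by (rule set_integrable_subset) auto
qed

lemma set_integral_reflect_zero:
  fixes f :: "real \<Rightarrow> real"
  shows "(LINT b:{..<0}|lborel. f b) = (LINT b:{0<..}|lborel. f (- b))"
  unfolding set_lebesgue_integral_def
  by (subst lborel_integral_real_affine[where c="-1" and t=0])
    (auto simp: indicator_def intro!: Bochner_Integration.integral_cong)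

lemma set_integral_reflect_Ioo:
  fixes f :: "real \<Rightarrow> real"
  shows "(LINT \<tau>:{0<..<t}|lborel. f (t - \<tau>)) = (LINT \<tau>:{0<..<t}|lborel. f \<tau>)"
  unfolding set_lebesgue_integral_def
  by (subst lborel_integral_real_affine[where c="-1" and t=t])
    (auto simp: indicator_def intro!: Bochner_Integration.integral_cong)

section \<open>The common double integral\<close>

text \<open>The inner integral is a time convolution of two first-passage densities. The
  \<open>m1\<close>, \<open>m2\<close> stand for drifts already divided by the volatilities
  \<open>s1\<close>, \<open>s2\<close>. The slots are not interchangeable in use: \<open>w\<close>
  is kept away from 0, while \<open>u\<close> may vanish.\<close>

definition hit_hit_integral ::
  "real \<Rightarrow> real \<Rightarrow> real \<Rightarrow> real \<Rightarrow> real \<Rightarrow> real \<Rightarrow> real \<Rightarrow> real \<Rightarrow> real" where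
  "hit_hit_integral t c s1 m1 s2 m2 u w =
    (LINT b:{0<..}|lborel. LINT \<tau>:{0<..<t}|lborel.
       exp (c * b) * hit_density (t - \<tau>) ((b + w) / s2) m2 * hit_density \<tau> ((b + u) / s1) m1)"

text \<open>The factor at distance \<open>w\<close> is bounded because \<open>w\<close> stays away from \<open>0\<close>; the other one
  has the singularity \<open>b powr (-1/2) * \<tau> powr (-3/4)\<close>, integrable in both variables.\<close>

lemma continuous_on_hit_hit_integral:
  fixes u w :: "'a :: metric_space \<Rightarrow> real"
  assumes pos: "t > 0" "s1 > 0" "s2 > 0" "\<delta> > 0"
    and "continuous_on S u" "continuous_on S w"
    and u: "\<And>x. x \<in> S \<Longrightarrow> u x \<ge> 0" and w: "\<And>x. x \<in> S \<Longrightarrow> w x \<ge> \<delta>"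
  shows "continuous_on S (\<lambda>x. hit_hit_integral t c s1 m1 s2 m2 (u x) (w x))"
proof -
  \<comment> \<open>At argument \<open>b / s1\<close> this rate gives decay
    \<open>exp (- (\<bar>c\<bar> + 1) * b)\<close>, which offsets \<open>exp (c * b)\<close> and
    leaves \<open>exp (- b)\<close>.\<close>
  define k where "k = s1 * (\<bar>c\<bar> + 1)"
  define K2 where "K2 = 65 * exp (t * m2\<^sup>2) / (\<delta> / s2)\<^sup>2"
  define K1 where "K1 = 4 * exp (t * (\<bar>m1\<bar> + k)\<^sup>2) * (1 / s1) powr (-1/2)"
  have K: "K1 \<ge> 0" "K2 \<ge> 0" by (simp_all add: K1_def K2_def)
  show ?thesis
    unfolding hit_hit_integral_def
  proof (rule continuous_on_iterated_integral)
    show "set_integrable lborel {0<..} (\<lambda>b. (K1 * K2) * (b powr (-1/2) * exp (- b)))"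
      by (intro set_integrable_mult_right set_integrable_powr_exp_Ioi) simp
    show "set_integrable lborel {0<..<t} (\<lambda>\<tau>. \<tau> powr (-3/4))"
      using pos by (intro set_integrable_powr_Ioo) auto
    fix b \<tau> :: real assume b: "b \<in> {0<..}" and \<tau>: "\<tau> \<in> {0<..<t}"
    then show "continuous_on S (\<lambda>x. exp (c * b) * hit_density (t - \<tau>) ((b + w x) / s2) m2 *
        hit_density \<tau> ((b + u x) / s1) m1)"
      using pos assms(5,6) by (intro continuous_intros) auto
    fix x assume x: "x \<in> S"
    let ?y1 = "(b + u x) / s1" and ?y2 = "(b + w x) / s2"
    have y1: "?y1 \<ge> b / s1" "b / s1 > 0" using u[OF x] b pos by (auto simp: divide_right_mono)
    have y2: "?y2 \<ge> \<delta> / s2" "\<delta> / s2 > 0" using w[OF x] b pos by (auto simp: divide_right_mono)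
    have "hit_density (t - \<tau>) ?y2 m2 \<le> 65 * exp (t * m2\<^sup>2) / ?y2\<^sup>2"
      using \<tau> y2 by (intro hit_density_le) auto
    also have "\<dots> \<le> K2"
      unfolding K2_def using y2 by (intro divide_left_mono power_mono mult_pos_pos) auto
    finally have h2: "hit_density (t - \<tau>) ?y2 m2 \<le> K2" .
    have "hit_density \<tau> ?y1 m1
        \<le> 4 * exp (t * (\<bar>m1\<bar> + k)\<^sup>2) * ?y1 powr (-1/2) * exp (- k * ?y1) * \<tau> powr (-3/4)"
      using \<tau> y1 by (intro hit_density_le) auto
    \<comment> \<open>As \<open>u x \<ge> 0\<close>, dropping it only increases the bound, which
      becomes uniform in \<open>x\<close>.\<close>
    also have "\<dots> \<le> 4 * exp (t * (\<bar>m1\<bar> + k)\<^sup>2) * (b / s1) powr (-1/2) * exp (- k * (b / s1)) * \<tau> powr (-3/4)"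
    proof -
      have "?y1 powr (-1/2) \<le> (b / s1) powr (-1/2)"
        using y1 by (intro powr_mono2') auto
      moreover have "exp (- k * ?y1) \<le> exp (- k * (b / s1))"
        using u[OF x] pos by (simp add: k_def mult_left_mono)
      ultimately show ?thesis by (intro mult_mono order_refl) auto
    qed
    also have "\<dots> = K1 * b powr (-1/2) * exp (- (\<bar>c\<bar> + 1) * b) * \<tau> powr (-3/4)"
    proof -
      have "(b / s1) powr (-1/2) = b powr (-1/2) * (1 / s1) powr (-1/2)"
        using b pos powr_mult[of b "1 / s1" "-1/2"] by simp
      moreover have "k * (b / s1) = (\<bar>c\<bar> + 1) * b" using pos by (simp add: k_def)
      then have "- k * (b / s1) = - (\<bar>c\<bar> + 1) * b"
        by (simp only: mult_minus_left)
      ultimately show ?thesis by (simp only: K1_def mult_ac)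
    qed
    finally have h1: "hit_density \<tau> ?y1 m1 \<le> K1 * b powr (-1/2) * exp (- (\<bar>c\<bar> + 1) * b) * \<tau> powr (-3/4)" .
    have e: "exp (c * b) * exp (- (\<bar>c\<bar> + 1) * b) \<le> exp (- b)"
    proof -
      have "c * b \<le> \<bar>c\<bar> * b" using b by (intro mult_right_mono) auto
      then show ?thesis by (simp add: algebra_simps flip: exp_add)
    qed
    have "\<bar>exp (c * b) * hit_density (t - \<tau>) ?y2 m2 * hit_density \<tau> ?y1 m1\<bar>
        = exp (c * b) * hit_density (t - \<tau>) ?y2 m2 * hit_density \<tau> ?y1 m1"
      using \<tau> by (simp add: abs_mult hit_density_nonneg)
    also have "\<dots> \<le> exp (c * b) * K2 * (K1 * b powr (-1/2) * exp (- (\<bar>c\<bar> + 1) * b) * \<tau> powr (-3/4))"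
      using \<tau> K by (intro mult_mono h1 h2 order_refl mult_nonneg_nonneg hit_density_nonneg) auto
    also have "\<dots> = (exp (c * b) * exp (- (\<bar>c\<bar> + 1) * b)) * (K1 * K2 * b powr (-1/2) * \<tau> powr (-3/4))"
      by (simp add: mult_ac)
    also have "\<dots> \<le> exp (- b) * (K1 * K2 * b powr (-1/2) * \<tau> powr (-3/4))"
      using K by (intro mult_right_mono e) auto
    finally show "\<bar>exp (c * b) * hit_density (t - \<tau>) ?y2 m2 * hit_density \<tau> ?y1 m1\<bar>
        \<le> (K1 * K2) * (b powr (-1/2) * exp (- b)) * \<tau> powr (-3/4)"
      by (simp add: mult_ac)
  qed (simp_all add: split_beta')
qed

text \<open>For \<open>x\<close> and \<open>z\<close> on the same side of \<open>a\<close>, the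
  density formula attaches \<open>t - \<tau>\<close> to the factor that may start at distance 0.
  Reflecting time exchanges the two factors, and the prefactor depending on \<open>z\<close> moves
  inside as \<open>C\<close>.\<close>

lemma scaled_hit_hit_integral:
  "C * hit_hit_integral t c s1 m1 s2 m2 u w =
    (LINT b:{0<..}|lborel. LINT \<tau>:{0<..<t}|lborel.
       C * exp (c * b) * hit_density (t - \<tau>) ((b + u) / s1) m1 * hit_density \<tau> ((b + w) / s2) m2)"
proof -
  have "(LINT \<tau>:{0<..<t}|lborel.
       exp (c * b) * hit_density (t - \<tau>) ((b + w) / s2) m2 * hit_density \<tau> ((b + u) / s1) m1)
    = (LINT \<tau>:{0<..<t}|lborel.
       exp (c * b) * hit_density (t - \<tau>) ((b + u) / s1) m1 * hit_density \<tau> ((b + w) / s2) m2)" for b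
    using set_integral_reflect_Ioo[of t "\<lambda>\<tau>. exp (c * b) *
      hit_density \<tau> ((b + w) / s2) m2 * hit_density (t - \<tau>) ((b + u) / s1) m1"]
    by (simp add: mult_ac)
  then show ?thesis
    by (simp add: hit_hit_integral_def mult.assoc)
qed

text \<open>This matches the two one-sided expressions at \<open>x = a\<close>, where
  \<open>u = 0\<close>. Reversing both drifts contributes
  \<open>2 * m2 * (b + w) / s2 + 2 * m1 * b / s1\<close> to the exponent; its part
  \<open>2 * m2 * b / s2\<close> cancels the rate on the left.\<close>

lemma hit_hit_integral_minus_drifts:
  assumes "s1 > 0" "s2 > 0"
  shows "hit_hit_integral t (- (2 * m2 / s2)) s1 (- m1) s2 (- m2) 0 w
       = exp (2 * m2 * w / s2) * hit_hit_integral t (2 * m1 / s1) s1 m1 s2 m2 0 w"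
proof -
  have "exp (- (2 * m2 / s2) * b) * hit_density (t - \<tau>) ((b + w) / s2) (- m2) * hit_density \<tau> ((b + 0) / s1) (- m1)
      = exp (2 * m2 * w / s2) * (exp (2 * m1 / s1 * b) * hit_density (t - \<tau>) ((b + w) / s2) m2 * hit_density \<tau> ((b + 0) / s1) m1)"
    if "\<tau> \<in> {0<..<t}" for b \<tau>
  proof -
    have "- (2 * m2 / s2) * b + 2 * m2 * ((b + w) / s2) + 2 * m1 * ((b + 0) / s1) = 2 * m2 * w / s2 + 2 * m1 / s1 * b"
      using assms by (simp add: field_simps)
    then have "exp (- (2 * m2 / s2) * b) * exp (2 * m2 * ((b + w) / s2)) * exp (2 * m1 * ((b + 0) / s1))
        = exp (2 * m2 * w / s2) * exp (2 * m1 / s1 * b)"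
      by (simp only: exp_add[symmetric])
    then show ?thesis
      using that by (simp only: hit_density_minus_drift greaterThanLessThan_iff diff_gt_0_iff_gt) algebra
  qed
  then have "hit_hit_integral t (- (2 * m2 / s2)) s1 (- m1) s2 (- m2) 0 w =
    (LINT b:{0<..}|lborel. LINT \<tau>:{0<..<t}|lborel. exp (2 * m2 * w / s2) *
       (exp (2 * m1 / s1 * b) * hit_density (t - \<tau>) ((b + w) / s2) m2 * hit_density \<tau> ((b + 0) / s1) m1))"
    unfolding hit_hit_integral_def by (intro set_lebesgue_integral_cong allI impI) simp_all
  then show ?thesis by (simp add: hit_hit_integral_def)
qed

section \<open>The Gaussian term\<close>

text \<open>For \<open>x\<close> and \<open>z\<close> on the same side of \<open>a\<close>, this is
  the method-of-images density of a Brownian motion with drift \<open>\<mu>\<close> and volatility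
  \<open>\<sigma>\<close>, killed at \<open>a\<close>.\<close>

definition reflected_gaussian :: "real \<Rightarrow> real \<Rightarrow> real \<Rightarrow> real \<Rightarrow> real \<Rightarrow> real \<Rightarrow> real" where
  "reflected_gaussian a \<mu> \<sigma> t x z = 1 / sqrt (2 * pi * t * \<sigma>\<^sup>2) *
     (exp (- ((z - x - \<mu> * t)\<^sup>2) / (2 * t * \<sigma>\<^sup>2)) -
      exp (- ((z + x - 2 * a - \<mu> * t)\<^sup>2) / (2 * t * \<sigma>\<^sup>2) - 2 * \<mu> * (x - a) / \<sigma>\<^sup>2))"

lemma reflected_gaussian_at_barrier [simp]: "reflected_gaussian a \<mu> \<sigma> t a z = 0"
  by (simp add: reflected_gaussian_def)

lemma continuous_on_reflected_gaussian [continuous_intros]: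
  "t > 0 \<Longrightarrow> \<sigma> > 0 \<Longrightarrow> continuous_on S (\<lambda>x. reflected_gaussian a \<mu> \<sigma> t x z)"
  unfolding reflected_gaussian_def by (intro continuous_intros) auto

section \<open>The branches of the density in common form\<close>

lemma explicit_density_ge_ge:
  assumes "a \<le> x" "a \<le> z"
  shows "explicit_density a \<mu>1 \<mu>2 \<sigma>1 \<sigma>2 t x z =
    2 / \<sigma>2\<^sup>2 * (exp (2 * \<mu>2 * (z - a) / \<sigma>2\<^sup>2) *
      hit_hit_integral t (2 * \<mu>1 / \<sigma>1\<^sup>2) \<sigma>1 (\<mu>1 / \<sigma>1) \<sigma>2 (\<mu>2 / \<sigma>2) 0 (z + x - 2 * a)) +
    reflected_gaussian a \<mu>2 \<sigma>2 t x z"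
proof -
  have "b + (z + x - 2 * a) = z + x - 2 * a + b" for b by simp
  then show ?thesis
    using assms unfolding explicit_density_def reflected_gaussian_def scaled_hit_hit_integral
    by (simp only: if_True add_0_right times_divide_eq_left)
qed

lemma explicit_density_ge_less:
  assumes "a \<le> x" "z < a"
  shows "explicit_density a \<mu>1 \<mu>2 \<sigma>1 \<sigma>2 t x z =
    2 / \<sigma>1\<^sup>2 * hit_hit_integral t (2 * \<mu>1 / \<sigma>1\<^sup>2) \<sigma>2 (\<mu>2 / \<sigma>2) \<sigma>1 (\<mu>1 / \<sigma>1) (x - a) (a - z)"
  using assms unfolding explicit_density_def hit_hit_integral_def
  by (simp add: algebra_simps)

text \<open>The reflection of \<open>b\<close> makes both distances negative; restoring their sign
  reverses both drifts, hence the minus signs throughout.\<close>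

lemma explicit_density_less_le:
  assumes "x < a" "z \<le> a"
  shows "explicit_density a \<mu>1 \<mu>2 \<sigma>1 \<sigma>2 t x z =
    2 / \<sigma>1\<^sup>2 * (exp (2 * \<mu>1 * (z - a) / \<sigma>1\<^sup>2) *
      hit_hit_integral t (- (2 * \<mu>2 / \<sigma>2\<^sup>2)) \<sigma>2 (- (\<mu>2 / \<sigma>2)) \<sigma>1 (- (\<mu>1 / \<sigma>1)) 0 (2 * a - z - x)) +
    reflected_gaussian a \<mu>1 \<sigma>1 t x z"
proof -
  have "(z + x - 2 * a + - b) / \<sigma>1 = - ((b + (2 * a - z - x)) / \<sigma>1)" for b
    unfolding minus_divide_left by (rule arg_cong[where f="\<lambda>v. v / \<sigma>1"]) simp
  then have *: "hit_density s ((z + x - 2 * a + - b) / \<sigma>1) m = hit_density s ((b + (2 * a - z - x)) / \<sigma>1) (- m)"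
    "hit_density s (- b / \<sigma>2) m = hit_density s (b / \<sigma>2) (- m)" for s b m
    by (simp_all only: hit_density_minus minus_divide_left[symmetric])
  show ?thesis
    using assms unfolding explicit_density_def reflected_gaussian_def scaled_hit_hit_integral
      set_integral_reflect_zero *
    by simp
qed

lemma explicit_density_less_gt:
  assumes "x < a" "a < z"
  shows "explicit_density a \<mu>1 \<mu>2 \<sigma>1 \<sigma>2 t x z =
    2 / \<sigma>2\<^sup>2 * hit_hit_integral t (- (2 * \<mu>2 / \<sigma>2\<^sup>2)) \<sigma>1 (- (\<mu>1 / \<sigma>1)) \<sigma>2 (- (\<mu>2 / \<sigma>2)) (a - x) (z - a)"
proof -
  have "(- b - z + a) / \<sigma>2 = - ((b + (z - a)) / \<sigma>2)"
    "(x - a + - b) / \<sigma>1 = - ((b + (a - x)) / \<sigma>1)" for b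
    unfolding minus_divide_left by (rule arg_cong[where f="\<lambda>v. v / _"], simp)+
  then have *: "hit_density s ((- b - z + a) / \<sigma>2) m = hit_density s ((b + (z - a)) / \<sigma>2) (- m)"
    "hit_density s ((x - a + - b) / \<sigma>1) m = hit_density s ((b + (a - x)) / \<sigma>1) (- m)" for s b m
    by (simp_all only: hit_density_minus)
  show ?thesis
    using assms unfolding explicit_density_def hit_hit_integral_def set_integral_reflect_zero *
    by simp
qed

text \<open>The point \<open>x = a\<close> belongs to the other branch by definition. There the
  Gaussian term vanishes and the drift reversal identifies the integrals, so the left-hand formula
  extends to the closed half-line.\<close>

lemma explicit_density_le_less:
  assumes "x \<le> a" "z < a" "\<sigma>1 > 0" "\<sigma>2 > 0"
  shows "explicit_density a \<mu>1 \<mu>2 \<sigma>1 \<sigma>2 t x z =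
    2 / \<sigma>1\<^sup>2 * (exp (2 * \<mu>1 * (z - a) / \<sigma>1\<^sup>2) *
      hit_hit_integral t (- (2 * \<mu>2 / \<sigma>2\<^sup>2)) \<sigma>2 (- (\<mu>2 / \<sigma>2)) \<sigma>1 (- (\<mu>1 / \<sigma>1)) 0 (2 * a - z - x)) +
    reflected_gaussian a \<mu>1 \<sigma>1 t x z"
proof (cases "x = a")
  case True
  then show ?thesis
    \<comment> \<open>The drifts are inserted with a minus sign so that the left side of the
      identity is the integral of the branch \<open>a \<le> x\<close>.\<close>
    using assms hit_hit_integral_minus_drifts[of \<sigma>2 \<sigma>1 t "- (\<mu>1 / \<sigma>1)" "- (\<mu>2 / \<sigma>2)" "a - z"]
    by (simp add: explicit_density_ge_less power2_eq_square algebra_simps diff_divide_distrib)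
qed (use assms in \<open>simp add: explicit_density_less_le\<close>)

text \<open>At \<open>x = a\<close> the drift reversal supplies exactly the factor
  \<open>exp (2 * \<mu>2 * (z - a) / \<sigma>2^2)\<close> of the branch
  \<open>a \<le> x\<close>.\<close>

lemma explicit_density_le_gt:
  assumes "x \<le> a" "a < z" "\<sigma>1 > 0" "\<sigma>2 > 0"
  shows "explicit_density a \<mu>1 \<mu>2 \<sigma>1 \<sigma>2 t x z =
    2 / \<sigma>2\<^sup>2 * hit_hit_integral t (- (2 * \<mu>2 / \<sigma>2\<^sup>2)) \<sigma>1 (- (\<mu>1 / \<sigma>1)) \<sigma>2 (- (\<mu>2 / \<sigma>2)) (a - x) (z - a)"
proof (cases "x = a")
  case True
  then show ?thesis
    using assms hit_hit_integral_minus_drifts[of \<sigma>1 \<sigma>2 t "\<mu>2 / \<sigma>2" "\<mu>1 / \<sigma>1" "z - a"]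
    by (simp add: explicit_density_ge_ge power2_eq_square algebra_simps)
qed (use assms in \<open>simp add: explicit_density_less_gt\<close>)

section \<open>Continuity in the starting point\<close>

lemma continuous_on_explicit_density:
  assumes "\<sigma>1 > 0" "\<sigma>2 > 0" "t > 0" "z \<noteq> a"
  shows "continuous_on UNIV (\<lambda>x. explicit_density a \<mu>1 \<mu>2 \<sigma>1 \<sigma>2 t x z)" (is "continuous_on _ ?p")
proof -
  have "continuous_on {..a} ?p \<and> continuous_on {a..} ?p"
  proof (cases "z < a")
    case True
    have "continuous_on {..a} ?p = continuous_on {..a} (\<lambda>x. 2 / \<sigma>1\<^sup>2 * (exp (2 * \<mu>1 * (z - a) / \<sigma>1\<^sup>2) *
      hit_hit_integral t (- (2 * \<mu>2 / \<sigma>2\<^sup>2)) \<sigma>2 (- (\<mu>2 / \<sigma>2)) \<sigma>1 (- (\<mu>1 / \<sigma>1)) 0 (2 * a - z - x)) +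
      reflected_gaussian a \<mu>1 \<sigma>1 t x z)"
      using True assms by (intro continuous_on_cong refl) (simp add: explicit_density_le_less)
    moreover have "continuous_on {a..} ?p = continuous_on {a..} (\<lambda>x. 2 / \<sigma>1\<^sup>2 *
      hit_hit_integral t (2 * \<mu>1 / \<sigma>1\<^sup>2) \<sigma>2 (\<mu>2 / \<sigma>2) \<sigma>1 (\<mu>1 / \<sigma>1) (x - a) (a - z))"
      using True assms by (intro continuous_on_cong refl) (simp add: explicit_density_ge_less)
    ultimately show ?thesis
      \<comment> \<open>For \<open>x \<le> a\<close> one has
        \<open>2 * a - z - x \<ge> a - z\<close>, and on the other side \<open>w\<close> equals
        \<open>a - z\<close>; thus one \<open>\<delta>\<close> serves both halves.\<close>
      using True assms by (auto intro!: continuous_intros continuous_on_hit_hit_integral[where \<delta>="a - z"])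
  next
    case False
    have "continuous_on {a..} ?p = continuous_on {a..} (\<lambda>x. 2 / \<sigma>2\<^sup>2 * (exp (2 * \<mu>2 * (z - a) / \<sigma>2\<^sup>2) *
      hit_hit_integral t (2 * \<mu>1 / \<sigma>1\<^sup>2) \<sigma>1 (\<mu>1 / \<sigma>1) \<sigma>2 (\<mu>2 / \<sigma>2) 0 (z + x - 2 * a)) +
      reflected_gaussian a \<mu>2 \<sigma>2 t x z)"
      using False assms by (intro continuous_on_cong refl) (simp add: explicit_density_ge_ge)
    moreover have "continuous_on {..a} ?p = continuous_on {..a} (\<lambda>x. 2 / \<sigma>2\<^sup>2 *
      hit_hit_integral t (- (2 * \<mu>2 / \<sigma>2\<^sup>2)) \<sigma>1 (- (\<mu>1 / \<sigma>1)) \<sigma>2 (- (\<mu>2 / \<sigma>2)) (a - x) (z - a))"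
      using False assms by (intro continuous_on_cong refl) (simp add: explicit_density_le_gt)
    ultimately show ?thesis
      using False assms by (auto intro!: continuous_intros continuous_on_hit_hit_integral[where \<delta>="z - a"])
  qed
  \<comment> \<open>Both half-lines are closed and the same function is continuous on each, so the
    pieces glue at \<open>a\<close>.\<close>
  then have "continuous_on ({..a} \<union> {a..}) ?p"
    by (intro continuous_on_closed_Un) auto
  moreover have "{..a} \<union> {a..} = UNIV" by auto
  ultimately show ?thesis by simp
qed

theorem corollary4p2:
  fixes a \<mu>1 \<mu>2 \<sigma>1 \<sigma>2 :: real
    and M :: "'w measure"
    and B :: "real \<Rightarrow> 'w \<Rightarrow> real"
    and X :: "real \<Rightarrow> real \<Rightarrow> 'w \<Rightarrow> real"
    and p :: "real \<Rightarrow> real \<Rightarrow> real \<Rightarrow> real"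
  assumes "\<sigma>1 > 0" and "\<sigma>2 > 0"
    and "standard_brownian_motion M B"
    and "\<And>x. strong_solution M B (two_valued a \<mu>1 \<mu>2) (two_valued a \<sigma>1 \<sigma>2) x (X x)"
    and "transition_density M X p"
    and "\<And>t x z. t > 0 \<Longrightarrow> p t x z = explicit_density a \<mu>1 \<mu>2 \<sigma>1 \<sigma>2 t x z"
  shows "\<forall>t>0. \<forall>z. z \<noteq> a \<longrightarrow> continuous_on UNIV (\<lambda>x. p t x z)"
  using assms(1,2,6) by (simp add: continuous_on_explicit_density)

end
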